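(* The hypergraph partition functions $Z_{\mathrm{RC}}$, $Z_{\mathrm{P}}$ and $Z_{\mathrm{Grimmett}}$ do not specialize to each other, even up to multiplication by a factor depending only on global parameters. That is, for any two distinct $F_1,F_2\in\{Z_{\mathrm{RC}},Z_{\mathrm{P}},Z_{\mathrm{Grimmett}}\}$, there do not exist a field $K\supseteq\mathbb{C}(q,w)$, elements $s,t\in K$ and a function $c$ with values in $K$ such that for all hypergraphs $H$ $$F_2(H;q,w)=c\big(v(H),\kappa(H),|E(H)|,d(E(H))\big)\cdot F_1(H;s,t).$$
   Context: A hypergraph is a pair $H=(V,E)$ where $V$ is a finite set and $E=E(H)$ is a finite multiset (parallel hyperedges are allowed and treated as distinct elements of $E$) of multisets of elements of $V$, called hyperedges. For $e\in E$, $d(e)$ is the size of $e$ counted with multiplicity; it is always assumed that $d(e)>1$. Write $v(H)=|V|$. $\kappa(H)$ is the number of connected components of the bipartite incidence graph with vertex classes $V$ and $E$, in which $u\in V$ and $e\in E$ are joined by as many edges as the multiplicity of $u$ in $e$. For $A\subseteq E$ let $\kappa(A)=\kappa((V,A))$, $d(A)=\sum_{e\in A}d(e)$, and $|A|$ is the number of hyperedges in $A$. The global parameters of $H$ are the number of vertices $v(H)$, of components $\kappa(H)$, of edges $|E(H)|$, and the total degree $d(E(H))$. The partition functions, as polynomials in two variables, are $Z_{\mathrm{RC}}(H;q,v)=\sum_{A\subseteq E}q^{\kappa(A)}\prod_{e\in A}v^{d(e)-1}$, $Z_{\mathrm{P}}(H;q,w)=\sum_{A\subseteq E}q^{\kappa(A)}\prod_{e\in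 A}(w^{d(e)-1}-1)$, $Z_{\mathrm{Grimmett}}(H;q,w)=\sum_{A\subseteq E}q^{\kappa(A)}(w-1)^{|A|}$. ($q,w$ are indeterminates; the second variable of $Z_{\mathrm{RC}}$ may be renamed $w$.) One invariant specializes to another if the latter is obtained from the former by a fixed substitution for its variables. *)

theory Defs
  imports Complex_Main "HOL-Library.Multiset" "HOL-Computational_Algebra.Computational_Algebra"
begin

text \<open>
  The multiset of hyperedges is given as a family of vertex multisets indexed by edge labels, so
  that parallel hyperedges are distinct elements of the edge set.
\<close>

record ('v, 'e) hypergraph =
  verts :: "'v set"
  edges :: "'e set"
  ends :: "'e \<Rightarrow> 'v multiset"

definition edge_degree :: "('v, 'e) hypergraph \<Rightarrow> 'e \<Rightarrow> nat" where
  "edge_degree H e = size (ends H e)"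

definition is_hypergraph :: "('v, 'e) hypergraph \<Rightarrow> bool" where
  "is_hypergraph H \<longleftrightarrow> finite (verts H) \<and> finite (edges H) \<and>
     (\<forall>e \<in> edges H. set_mset (ends H e) \<subseteq> verts H \<and> edge_degree H e > 1)"

text \<open>
  The bipartite incidence graph has node set \<open>V + E\<close>. Its edge multiplicities do not affect its
  components, so only the adjacency relation is recorded.
\<close>

definition incidence_nodes :: "('v, 'e) hypergraph \<Rightarrow> ('v + 'e) set" where
  "incidence_nodes H = Inl ` verts H \<union> Inr ` edges H"

definition incidence_adj :: "('v, 'e) hypergraph \<Rightarrow> (('v + 'e) \<times> ('v + 'e)) set" where
  "incidence_adj H =
     {(Inl u, Inr e) | u e. u \<in> verts H \<and> e \<in> edges H \<and> u \<in># ends H e} \<union>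
     {(Inr e, Inl u) | u e. u \<in> verts H \<and> e \<in> edges H \<and> u \<in># ends H e}"

definition incidence_components :: "('v, 'e) hypergraph \<Rightarrow> ('v + 'e) set set" where
  "incidence_components H =
     incidence_nodes H // ((incidence_adj H)\<^sup>* \<inter> incidence_nodes H \<times> incidence_nodes H)"

definition kappa :: "('v, 'e) hypergraph \<Rightarrow> nat" where
  "kappa H = card (incidence_components H)"

definition kappa_on :: "('v, 'e) hypergraph \<Rightarrow> 'e set \<Rightarrow> nat" where
  "kappa_on H A = kappa (H\<lparr>edges := A\<rparr>)"

definition total_degree :: "('v, 'e) hypergraph \<Rightarrow> nat" where
  "total_degree H = (\<Sum>e \<in> edges H. edge_degree H e)"

definition Z_RC :: "('v, 'e) hypergraph \<Rightarrow> 'k \<Rightarrow> 'k \<Rightarrow> 'k::comm_ring_1" where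
  "Z_RC H q v =
     (\<Sum>A \<in> Pow (edges H). q ^ kappa_on H A * (\<Prod>e \<in> A. v ^ (edge_degree H e - 1)))"

definition Z_P :: "('v, 'e) hypergraph \<Rightarrow> 'k \<Rightarrow> 'k \<Rightarrow> 'k::comm_ring_1" where
  "Z_P H q w =
     (\<Sum>A \<in> Pow (edges H). q ^ kappa_on H A * (\<Prod>e \<in> A. (w ^ (edge_degree H e - 1) - 1)))"

definition Z_Grimmett :: "('v, 'e) hypergraph \<Rightarrow> 'k \<Rightarrow> 'k \<Rightarrow> 'k::comm_ring_1" where
  "Z_Grimmett H q w = (\<Sum>A \<in> Pow (edges H). q ^ kappa_on H A * (w - 1) ^ card A)"

text \<open>
  Names for the three invariants, so that distinctness is that of the names and does not depend
  on the ring in which they are evaluated.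
\<close>

datatype partition_function = RC | Potts | Grimmett

fun Z_of :: "partition_function \<Rightarrow> ('v, 'e) hypergraph \<Rightarrow> 'k \<Rightarrow> 'k \<Rightarrow> 'k::comm_ring_1" where
  "Z_of RC = Z_RC"
| "Z_of Potts = Z_P"
| "Z_of Grimmett = Z_Grimmett"

text \<open>
  The field \<open>\<complex>(q,w)\<close> as the fraction field of \<open>\<complex>[q][w]\<close>: the inner polynomial variable is \<open>q\<close>
  and the outer one is \<open>w\<close>.
\<close>

type_synonym Cqw = "complex poly poly fract"

definition q_var :: Cqw where "q_var = to_fract [:[:0, 1:]:]"

definition w_var :: Cqw where "w_var = to_fract [:0, 1:]"

text \<open>
  A field extension of \<open>'a\<close> is given by a unital ring homomorphism into \<open>'b\<close>, which is
  automatically injective.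
\<close>

definition field_embedding :: "('a::field \<Rightarrow> 'b::field) \<Rightarrow> bool" where
  "field_embedding \<iota> \<longleftrightarrow> \<iota> 1 = 1 \<and>
     (\<forall>x y. \<iota> (x + y) = \<iota> x + \<iota> y) \<and> (\<forall>x y. \<iota> (x * y) = \<iota> x * \<iota> y)"

end

theory Submission imports Defs begin

text \<open>
  Only hypergraphs on two vertices are needed, with a set \<open>L\<close> of loops at the first vertex and a set
  \<open>B\<close> of hyperedges meeting both vertices. If a hyperedge \<open>e\<close> has weight \<open>x\<^sub>e\<close>, the partition function
  is \<open>q \<Prod>\<^bsub>L \<union> B\<^esub> (1 + x\<^sub>e) + (q\<^sup>2 - q) \<Prod>\<^bsub>L\<^esub> (1 + x\<^sub>e)\<close>. Hypergraphs with equal global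
  parameters share the factor \<open>c\<close>, so a relation between their \<open>F\<^sub>1\<close>-values passes to their
  \<open>F\<^sub>2\<close>-values, and conversely if \<open>c \<noteq> 0\<close>.

  Loops of degrees 2, 4 and loops of degrees 3, 3 have equal values under the Potts and Grimmett
  functions, but not under the random cluster function unless its second variable is 0 or 1. A loop
  and a bridge of degrees 2, 3 or 3, 2 have equal values under Grimmett's function (and under the
  random cluster function at 0 or 1), but not under the Potts function unless one of its variables
  is 1 or the second one is 0. Those degenerate Potts values also agree with the one for two bridges,
  or vanish on loops, which is false for Grimmett's function. Finally, three edges of degree 2, of
  which \<open>m\<close> are loops, give \<open>q (w\<^sup>3 + (q - 1) w\<^sup>m)\<close> under Grimmett's function. This depends on
  \<open>m\<close>, which excludes the random cluster function at 0, and it is not proportional to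
  \<open>8 + (s - 1) 2\<^sup>m\<close>, which excludes the random cluster function at 1.
\<close>

subsection \<open>Hypergraphs on two vertices\<close>

text \<open>An edge \<open>e\<close> consists of \<open>d e - 1\<close> copies of vertex 0 and one
  further end, so \<open>d e \<ge> 2\<close> makes every edge meet vertex 0 and have degree
  \<open>d e\<close>.\<close>

definition two_vertex :: "(nat \<Rightarrow> nat) \<Rightarrow> nat set \<Rightarrow> nat set \<Rightarrow> (nat, nat) hypergraph" where
  "two_vertex d L B = \<lparr>verts = {0, 1}, edges = L \<union> B,
     ends = (\<lambda>e. add_mset (if e \<in> B then 1 else 0) (replicate_mset (d e - 1) 0))\<rparr>"

lemma two_vertex_simps [simp]:
  "verts (two_vertex d L B) = {0, 1}"
  "edges (two_vertex d L B) = L \<union> B"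
  by (simp_all add: two_vertex_def)

lemma edge_degree_two_vertex: "d e \<ge> 2 \<Longrightarrow> edge_degree (two_vertex d L B) e = d e"
  by (simp add: edge_degree_def two_vertex_def)

lemma is_hypergraph_two_vertex:
  assumes "finite L" "finite B" "\<And>e. d e \<ge> 2"
  shows "is_hypergraph (two_vertex d L B)"
  unfolding is_hypergraph_def
proof (intro conjI ballI)
  fix e
  show "1 < edge_degree (two_vertex d L B) e"
    using assms(3)[of e] by (simp add: edge_degree_two_vertex)
qed (use assms in \<open>auto simp: two_vertex_def split: if_splits\<close>)

lemma total_degree_two_vertex:
  "(\<And>e. d e \<ge> 2) \<Longrightarrow> total_degree (two_vertex d L B) = sum d (L \<union> B)"
  by (simp add: total_degree_def edge_degree_two_vertex)

text \<open>The classes are the nonempty fibres of \<open>f\<close>, one for each value in its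
  image.\<close>

lemma card_quotient_kernel:
  "card (N // {(x, y). x \<in> N \<and> y \<in> N \<and> f x = f y}) = card (f ` N)"
proof -
  have "N // {(x, y). x \<in> N \<and> y \<in> N \<and> f x = f y} = (\<lambda>b. {y \<in> N. f y = b}) ` f ` N"
    by (auto simp: quotient_def image_image Image_def eq_commute)
  moreover have "inj_on (\<lambda>b. {y \<in> N. f y = b}) (f ` N)"
    by (rule inj_onI) blast
  ultimately show ?thesis
    by (simp add: card_image)
qed

lemma sym_incidence_adj: "sym (incidence_adj H)"
  by (auto simp: sym_def incidence_adj_def)

lemma kappa_on_two_vertex:
  assumes d: "\<And>e. d e \<ge> 2"
  shows "kappa_on (two_vertex d L B) A = (if A \<inter> B = {} then 2 else 1)"
proof -
  define H where "H = (two_vertex d L B)\<lparr>edges := A\<rparr>"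
  \<comment> \<open>All edges hang on vertex 0, so only vertex 1 can be separate, and it is so
    exactly when \<open>A\<close> contains no bridge. The fibres of \<open>f\<close> on the nodes
    are thus the components.\<close>
  define f :: "nat + nat \<Rightarrow> bool" where "f = (\<lambda>x. A \<inter> B = {} \<and> x = Inl 1)"
  let ?R = "(incidence_adj H)\<^sup>*" and ?N = "incidence_nodes H"
  have N: "?N = {Inl 0, Inl 1} \<union> Inr ` A"
    by (auto simp: incidence_nodes_def H_def)
  have ends: "ends H e = add_mset (if e \<in> B then 1 else 0) (replicate_mset (d e - 1) 0)" for e
    by (simp add: H_def two_vertex_def)
  have edges: "edges H = A"
    by (simp add: H_def)
  have adj0: "(Inr e, Inl 0) \<in> incidence_adj H" if "e \<in> A" for e
    using that d[of e] by (auto simp: incidence_adj_def ends) (auto simp: H_def)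
  have adj1: "(Inl 1, Inr e) \<in> incidence_adj H" if "e \<in> A" "e \<in> B" for e
    using that by (auto simp: incidence_adj_def ends) (auto simp: H_def)
  have symR: "sym ?R"
    by (intro sym_rtrancl sym_incidence_adj)
  have to0: "(x, Inl 0) \<in> ?R" if "x \<in> ?N" "\<not> f x" for x
  proof (cases "x = Inl 1")
    case True
    then have "A \<inter> B \<noteq> {}"
      using that by (simp add: f_def)
    then obtain e where "e \<in> A" "e \<in> B"
      by blast
    then show ?thesis
      using adj0 adj1 True by (meson converse_rtrancl_into_rtrancl r_into_rtrancl)
  next
    case False
    then show ?thesis
      using that adj0 by (auto simp: N)
  qed
  have step: "f x = f y" if "(x, y) \<in> incidence_adj H" for x y
    using that by (auto simp: incidence_adj_def ends edges f_def split: if_splits)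
  have pres: "f x = f y" if "(x, y) \<in> ?R" for x y
    using that by induction (auto dest: step)
  have conn: "(x, y) \<in> ?R" if "x \<in> ?N" "y \<in> ?N" "f x = f y" for x y
  proof (cases "f x")
    case True
    then show ?thesis
      using that by (auto simp: f_def)
  next
    case False
    then show ?thesis
      using to0 that symR by (metis rtrancl_trans symD)
  qed
  have "?R \<inter> ?N \<times> ?N = {(x, y). x \<in> ?N \<and> y \<in> ?N \<and> f x = f y}"
    using pres conn by auto
  then have "kappa H = card (f ` ?N)"
    by (simp add: kappa_def incidence_components_def card_quotient_kernel)
  also have "f ` ?N = (if A \<inter> B = {} then {False, True} else {False})"
    by (auto simp: N f_def)
  finally show ?thesis
    by (simp add: kappa_on_def H_def)
qed

lemma kappa_two_vertex:
  assumes "\<And>e. d e \<ge> 2"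
  shows "kappa (two_vertex d L B) = (if B = {} then 2 else 1)"
proof -
  have "kappa (two_vertex d L B) = kappa_on (two_vertex d L B) (L \<union> B)"
    by (simp add: kappa_on_def two_vertex_def)
  moreover have "(L \<union> B) \<inter> B = B"
    by blast
  ultimately show ?thesis
    by (simp add: kappa_on_two_vertex assms)
qed

subsection \<open>Partition functions of hypergraphs on two vertices\<close>

fun weight :: "partition_function \<Rightarrow> 'k \<Rightarrow> nat \<Rightarrow> 'k::comm_ring_1" where
  "weight RC w n = w ^ (n - 1)"
| "weight Potts w n = w ^ (n - 1) - 1"
| "weight Grimmett w n = w - 1"

lemma Z_of_eq_sum_weight:
  "Z_of F H q w =
     (\<Sum>A \<in> Pow (edges H). q ^ kappa_on H A * (\<Prod>e \<in> A. weight F w (edge_degree H e)))"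
  by (cases F) (simp_all add: Z_RC_def Z_P_def Z_Grimmett_def)

lemma sum_Pow_prod:
  fixes x :: "'a \<Rightarrow> 'k::comm_ring_1"
  assumes "finite S"
  shows "(\<Sum>A \<in> Pow S. \<Prod>e \<in> A. x e) = (\<Prod>e \<in> S. 1 + x e)"
  using prod_add[OF assms, of x "\<lambda>_. 1"] by (simp add: add.commute)

text \<open>The power of \<open>q\<close> is \<open>q\<^sup>2\<close> for
  \<open>A \<subseteq> L\<close> and \<open>q\<close> otherwise. Writing
  \<open>q\<^sup>2 = q + (q\<^sup>2 - q)\<close> leaves two unrestricted sums over power sets, each
  of which factorises.\<close>

lemma Z_of_two_vertex:
  fixes q w :: "'k::comm_ring_1"
  assumes fin: "finite L" "finite B" and disj: "L \<inter> B = {}" and d: "\<And>e. d e \<ge> 2"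
  shows "Z_of F (two_vertex d L B) q w =
           q * (\<Prod>e \<in> L \<union> B. 1 + weight F w (d e)) +
           (q\<^sup>2 - q) * (\<Prod>e \<in> L. 1 + weight F w (d e))"
proof -
  define p where "p A = (\<Prod>e \<in> A. weight F w (d e))" for A
  have "Z_of F (two_vertex d L B) q w =
          (\<Sum>A \<in> Pow (L \<union> B). q * p A + (if A \<subseteq> L then (q\<^sup>2 - q) * p A else 0))"
    unfolding Z_of_eq_sum_weight
  proof (intro sum.cong)
    fix A
    assume "A \<in> Pow (L \<union> B)"
    then have "A \<inter> B = {} \<longleftrightarrow> A \<subseteq> L"
      using disj by blast
    then show "q ^ kappa_on (two_vertex d L B) A *
        (\<Prod>e \<in> A. weight F w (edge_degree (two_vertex d L B) e)) =
        q * p A + (if A \<subseteq> L then (q\<^sup>2 - q) * p A else 0)"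
      by (simp add: kappa_on_two_vertex edge_degree_two_vertex d p_def algebra_simps)
  qed simp
  also have "\<dots> = q * (\<Sum>A \<in> Pow (L \<union> B). p A) +
      (\<Sum>A \<in> Pow (L \<union> B). if A \<subseteq> L then (q\<^sup>2 - q) * p A else 0)"
    by (simp add: sum.distrib sum_distrib_left)
  also have "(\<Sum>A \<in> Pow (L \<union> B). if A \<subseteq> L then (q\<^sup>2 - q) * p A else 0) =
      (\<Sum>A \<in> Pow L. (q\<^sup>2 - q) * p A)"
    by (rule sum.mono_neutral_cong_right) (use fin in auto)
  also have "\<dots> = (q\<^sup>2 - q) * (\<Sum>A \<in> Pow L. p A)"
    by (simp add: sum_distrib_left)
  finally show ?thesis
    using fin by (simp add: p_def sum_Pow_prod)
qed

subsection \<open>The indeterminates in an extension field\<close>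

lemma field_embedding_0: "field_embedding \<iota> \<Longrightarrow> \<iota> 0 = 0"
  unfolding field_embedding_def by (metis add_cancel_right_right)

lemma field_embedding_eq_iff:
  assumes "field_embedding \<iota>"
  shows "\<iota> x = \<iota> y \<longleftrightarrow> x = y"
proof
  have hom: "\<iota> 1 = 1" "\<And>x y. \<iota> (x + y) = \<iota> x + \<iota> y" "\<And>x y. \<iota> (x * y) = \<iota> x * \<iota> y"
    using assms by (auto simp: field_embedding_def)
  assume "\<iota> x = \<iota> y"
  moreover have "\<iota> x = \<iota> (x - y) + \<iota> y"
    using hom(2)[of "x - y" y] by simp
  ultimately have "\<iota> (x - y) = 0"
    by simp
  then have "\<iota> ((x - y) * inverse (x - y)) = 0"
    using hom(3) by simp
  then show "x = y"
    using hom(1) by (cases "x = y") auto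
qed simp

lemma field_embedding_indeterminates:
  assumes "field_embedding (\<iota> :: Cqw \<Rightarrow> 'k::field)"
  shows "\<iota> q_var \<noteq> 0" "\<iota> q_var \<noteq> 1" "\<iota> w_var \<noteq> 0" "\<iota> w_var \<noteq> 1" "\<iota> w_var \<noteq> 2"
proof -
  have hom: "\<iota> 1 = 1" "\<And>x y. \<iota> (x + y) = \<iota> x + \<iota> y"
    using assms by (auto simp: field_embedding_def)
  have "\<iota> 0 = 0"
    by (rule field_embedding_0[OF assms])
  moreover have "\<iota> 2 = 2"
    using hom(2)[of 1 1] hom(1) by simp
  moreover have "q_var \<noteq> 0" "w_var \<noteq> 0"
    by (simp_all add: q_var_def w_var_def)
  moreover have "q_var \<noteq> 1" "w_var \<noteq> 1"
    unfolding q_var_def w_var_def to_fract_1[symmetric] to_fract_eq_iff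
    by (simp_all add: one_pCons)
  moreover have "w_var \<noteq> to_fract (1 + 1)"
    unfolding w_var_def to_fract_eq_iff by (simp add: one_pCons)
  then have "w_var \<noteq> 2"
    by (metis to_fract_add to_fract_1 one_add_one)
  ultimately show "\<iota> q_var \<noteq> 0" "\<iota> q_var \<noteq> 1" "\<iota> w_var \<noteq> 0" "\<iota> w_var \<noteq> 1" "\<iota> w_var \<noteq> 2"
    using field_embedding_eq_iff[OF assms] hom(1) by metis+
qed

theorem corollary5p9:
  fixes F1 F2 :: partition_function
  assumes "F1 \<noteq> F2"
  shows "\<not> (\<exists>(\<iota> :: Cqw \<Rightarrow> 'k::field) (s :: 'k) (t :: 'k)
                (c :: nat \<Rightarrow> nat \<Rightarrow> nat \<Rightarrow> nat \<Rightarrow> 'k).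
            field_embedding \<iota> \<and>
            (\<forall>H :: (nat, nat) hypergraph. is_hypergraph H \<longrightarrow>
               Z_of F2 H (\<iota> q_var) (\<iota> w_var) =
                 c (card (verts H)) (kappa H) (card (edges H)) (total_degree H) * Z_of F1 H s t))"
proof
  assume "\<exists>(\<iota> :: Cqw \<Rightarrow> 'k::field) (s :: 'k) (t :: 'k)
                (c :: nat \<Rightarrow> nat \<Rightarrow> nat \<Rightarrow> nat \<Rightarrow> 'k).
            field_embedding \<iota> \<and>
            (\<forall>H :: (nat, nat) hypergraph. is_hypergraph H \<longrightarrow>
               Z_of F2 H (\<iota> q_var) (\<iota> w_var) =
                 c (card (verts H)) (kappa H) (card (edges H)) (total_degree H) * Z_of F1 H s t)"
  then obtain \<iota> :: "Cqw \<Rightarrow> 'k" and s t :: 'k and c where \<iota>: "field_embedding \<iota>"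
    and eq: "\<And>H :: (nat, nat) hypergraph. is_hypergraph H \<Longrightarrow>
      Z_of F2 H (\<iota> q_var) (\<iota> w_var) =
        c (card (verts H)) (kappa H) (card (edges H)) (total_degree H) * Z_of F1 H s t"
    by blast
  define q w where "q = \<iota> q_var" and "w = \<iota> w_var"
  have ne: "q \<noteq> 0" "q \<noteq> 1" "w \<noteq> 0" "w \<noteq> 1" "w \<noteq> 2"
    using field_embedding_indeterminates[OF \<iota>] by (simp_all add: q_def w_def)
  define Z :: "partition_function \<Rightarrow> 'k \<Rightarrow> 'k \<Rightarrow> (nat \<Rightarrow> nat) \<Rightarrow> nat set \<Rightarrow> nat set \<Rightarrow> 'k"
    where "Z F q w d L B = q * (\<Prod>e \<in> L \<union> B. 1 + weight F w (d e)) +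
      (q\<^sup>2 - q) * (\<Prod>e \<in> L. 1 + weight F w (d e))" for F q w d L B
  have key: "Z F2 q w d L B =
      c 2 (if B = {} then 2 else 1) (card (L \<union> B)) (sum d (L \<union> B)) * Z F1 s t d L B"
    if "finite L" "finite B" "L \<inter> B = {}" "\<And>e. d e \<ge> 2" for d L B
    using eq[OF is_hypergraph_two_vertex[of L B d]] that
    by (simp add: Z_of_two_vertex kappa_two_vertex total_degree_two_vertex Z_def q_def w_def
        numeral_2_eq_2)
  define d24 d33 d23 d32 :: "nat \<Rightarrow> nat"
    where "d24 = (\<lambda>e. if e = 0 then 2 else 4)" and "d33 = (\<lambda>_. 3)"
      and "d23 = (\<lambda>e. if e = 0 then 2 else 3)" and "d32 = (\<lambda>e. if e = 0 then 3 else 2)"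
  note ds = d24_def d33_def d23_def d32_def
  have loops24: "Z F2 q w d24 {0, 1} {} = c 2 2 2 6 * Z F1 s t d24 {0, 1} {}"
    using key[of "{0, 1}" "{}" d24] by (simp add: ds numeral_2_eq_2)
  have loops33: "Z F2 q w d33 {0, 1} {} = c 2 2 2 6 * Z F1 s t d33 {0, 1} {}"
    using key[of "{0, 1}" "{}" d33] by (simp add: ds numeral_2_eq_2)
  have loops23: "Z F2 q w d23 {0, 1} {} = c 2 2 2 5 * Z F1 s t d23 {0, 1} {}"
    using key[of "{0, 1}" "{}" d23] by (simp add: ds numeral_2_eq_2)
  have mixed23: "Z F2 q w d23 {0} {1} = c 2 1 2 5 * Z F1 s t d23 {0} {1}"
    using key[of "{0}" "{1}" d23] by (simp add: ds numeral_2_eq_2)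
  have mixed32: "Z F2 q w d32 {0} {1} = c 2 1 2 5 * Z F1 s t d32 {0} {1}"
    using key[of "{0}" "{1}" d32] by (simp add: ds numeral_2_eq_2)
  have bridges23: "Z F2 q w d23 {} {0, 1} = c 2 1 2 5 * Z F1 s t d23 {} {0, 1}"
    using key[of "{}" "{0, 1}" d23] by (simp add: ds numeral_2_eq_2)
  have three: "Z F2 q w (\<lambda>_. 2) {..<m} {m..<3} = c 2 1 3 6 * Z F1 s t (\<lambda>_. 2) {..<m} {m..<3}"
    if "m < 3" for m
    using key[of "{..<m}" "{m..<3}" "\<lambda>_. 2"] that by (simp add: ivl_disj_un ivl_disj_int)
  have Z_three: "Z F x y (\<lambda>_. 2) {..<m} {m..<3} =
      x * ((1 + weight F y 2) ^ 3 + (x - 1) * (1 + weight F y 2) ^ m)" if "m < 3" for F x y m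
    using that by (simp add: Z_def ivl_disj_un power2_eq_square algebra_simps)
  have Z_loops: "Z F x y d {0, 1} {} =
      x\<^sup>2 * ((1 + weight F y (d 0)) * (1 + weight F y (d 1)))" for F x y d
    by (simp add: Z_def algebra_simps)
  have Z_mixed: "Z F x y d {0} {1} =
      x * (1 + weight F y (d 0)) * (x + weight F y (d 1))" for F x y d
    by (simp add: Z_def power2_eq_square algebra_simps)
  have Z_mixed23: "Z Potts x y d23 {0} {1} = x * (y * (x + y\<^sup>2 - 1))"
    and Z_mixed32: "Z Potts x y d32 {0} {1} = x * (y\<^sup>2 * (x + y - 1))" for x y
    unfolding Z_mixed by (simp_all add: ds)
  have Potts_mixed: "Z Potts q w d23 {0} {1} \<noteq> Z Potts q w d32 {0} {1}"
  proof
    assume "Z Potts q w d23 {0} {1} = Z Potts q w d32 {0} {1}"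
    then have "q * w * ((q - 1) * (w - 1)) = 0"
      unfolding Z_mixed23 Z_mixed32 by algebra
    then show False
      using ne by simp
  qed
  have RC_loops: "y * (y - 1) = 0"
    if "x \<noteq> 0" "Z RC x y d24 {0, 1} {} = Z RC x y d33 {0, 1} {}" for x y
  proof -
    have "(1 + y) * (1 + y ^ 3) = (1 + y\<^sup>2) * (1 + y\<^sup>2)"
      using that unfolding Z_loops by (simp add: ds)
    \<comment> \<open>This is the difference of the two sides.\<close>
    then have "y * (y - 1)\<^sup>2 = 0"
      by algebra
    then show ?thesis
      by simp
  qed
  have RC_01: "t = 0 \<or> t = 1" if "F1 = RC"
  proof -
    have "F2 = Potts \<or> F2 = Grimmett"
      using that assms by (cases F2) auto
    \<comment> \<open>On loops the Potts factors multiply to a power of \<open>w\<close> fixed by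
      the total degree, the Grimmett ones to a power fixed by the number of edges. The value is
      nonzero, so \<open>c\<close> can be cancelled.\<close>
    then have "Z F2 q w d24 {0, 1} {} = Z F2 q w d33 {0, 1} {}" "Z F2 q w d24 {0, 1} {} \<noteq> 0"
      using ne unfolding Z_loops by (auto simp: ds simp flip: power_Suc power_add)
    then have "s \<noteq> 0" "Z RC s t d24 {0, 1} {} = Z RC s t d33 {0, 1} {}"
      using loops24 loops33 that unfolding Z_loops by auto
    then show ?thesis
      using RC_loops by fastforce
  qed
  consider "F2 = RC" | "F1 = RC" "F2 = Potts" | "F1 = Grimmett" "F2 = Potts"
    | "F1 = RC" "F2 = Grimmett" | "F1 = Potts" "F2 = Grimmett"
    using assms by (cases F1; cases F2) auto
  then show False
  proof cases
    case 1
    then have "F1 = Potts \<or> F1 = Grimmett"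
      using assms by (cases F1) auto
    then have "Z F1 s t d24 {0, 1} {} = Z F1 s t d33 {0, 1} {}"
      unfolding Z_loops by (auto simp: ds simp flip: power_Suc power_add)
    then show False
      using RC_loops[of q w] loops24 loops33 1 ne by simp
  next
    case 2
    \<comment> \<open>At \<open>t = 0\<close> or \<open>t = 1\<close> the weight
      \<open>t ^ (n - 1)\<close> is the same for \<open>n = 2\<close> and
      \<open>n = 3\<close>.\<close>
    then have "Z F1 s t d23 {0} {1} = Z F1 s t d32 {0} {1}"
      using RC_01 unfolding Z_mixed by (auto simp: ds)
    then show False
      using Potts_mixed mixed23 mixed32 2 by simp
  next
    case 3
    then have "Z F1 s t d23 {0} {1} = Z F1 s t d32 {0} {1}"
      unfolding Z_mixed by (simp add: ds)
    then show False
      using Potts_mixed mixed23 mixed32 3 by simp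
  next
    case 4
    define C where "C = c 2 1 3 6 * s"
    have val: "q * (w ^ 3 + (q - 1) * w ^ m) = C * ((1 + t) ^ 3 + (s - 1) * (1 + t) ^ m)"
      if "m < 3" for m
      using three[OF that] 4 that by (simp add: Z_three C_def)
    \<comment> \<open>The left side is nonzero, which rules out \<open>t = 0\<close>. Passing to the
      next difference multiplies the left side by \<open>w\<close> and the right side by
      \<open>1 + t = 2\<close>, forcing \<open>w = 2\<close>.\<close>
    have diff: "q * (q - 1) * (w - 1) = C * (s - 1) * t"
      using val[of 0] val[of 1] by simp algebra
    then have "t = 1"
      using RC_01 4 ne by auto
    moreover have "q * (q - 1) * (w - 1) * w = C * (s - 1) * t * (1 + t)"
      using val[of 1] val[of 2] by simp algebra
    ultimately have "q * (q - 1) * (w - 1) * (w - 2) = 0"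
      using diff by algebra
    then show False
      using ne by simp
  next
    case 5
    have Z_Grimmett_mixed: "Z Grimmett q w d {0} {1} = q * w * (q + w - 1)" for d
      unfolding Z_mixed by simp
    have Z_bridges23: "Z Potts s t d23 {} {0, 1} = s * (t ^ 3 + (s - 1))"
      "Z Grimmett q w d23 {} {0, 1} = q * (w\<^sup>2 + (q - 1))"
      by (simp_all add: Z_def ds power2_eq_square power3_eq_cube algebra_simps)
    \<comment> \<open>At \<open>t = 0\<close> the Potts value on loops vanishes, while Grimmett's is
      \<open>q\<^sup>2 * w\<^sup>2\<close>.\<close>
    have "t \<noteq> 0"
      using loops23 5 ne unfolding Z_loops by (auto simp: ds)
    moreover have "c 2 1 2 5 * (s * t * ((s - 1) * (t - 1))) = 0"
      using mixed23 mixed32 unfolding 5 Z_mixed23 Z_mixed32 Z_Grimmett_mixed by algebra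
    ultimately have "c 2 1 2 5 * (s * ((s - 1) * (t - 1))) = 0"
      by simp
    \<comment> \<open>Replacing the loop of degree 2 by a bridge changes the Potts value by the very
      factor that was just shown to be killed by \<open>c\<close>.\<close>
    moreover have "q * ((q - 1) * (w - 1)) = c 2 1 2 5 * (s * ((s - 1) * (t - 1)))"
      using mixed23 bridges23 unfolding 5 Z_mixed23 Z_Grimmett_mixed Z_bridges23 by algebra
    ultimately show False
      using ne by auto
  qed
qed

end
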